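(* Let $V={\mathcal I}\oplus{\mathcal E}$ be a decomposition of $V$ into two maximal isotropic subspaces, and let $i_1,\dots,i_n$ and $e_1,\dots,e_n$ be bases of ${\mathcal I}$ and ${\mathcal E}$ with $g(e_a,i_b)=\frac12\delta_{ab}$. In terms of the basis $\{e_ae_b,\ i_ai_b : 1\le a<b\le n\}\cup\{e_ai_b-i_be_a : 1\le a,b\le n\}$ of $C^2$, the operator $\tilde L_2$ is given, for all $\psi_1,\psi_2\in S$, by $$\tilde L_2(\psi_1,\psi_2)=\sum_{a\ne b}B(e_ae_b\cdot\psi_1,\psi_2)\,i_ai_b+\sum_{a\ne b}B(i_ai_b\cdot\psi_1,\psi_2)\,e_ae_b+\sum_{a\ne b}B(e_ai_b\cdot\psi_1,\psi_2)(i_ae_b-e_bi_a)$$ $$\qquad+\frac12\sum_{a}B((e_ai_a-i_ae_a)\cdot\psi_1,\psi_2)(i_ae_a-e_ai_a),$$ where all indices run over $\{1,\dots,n\}$.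
   Context: $k$ is a field of characteristic not $2$ or $3$; $V$ is a $2n$-dimensional $k$-vector space with a nondegenerate symmetric bilinear form $g$ of Witt index $n$ (hyperbolic). $C=C(V,g)$ is the Clifford algebra, $vw+wv=2g(v,w)1$ for $v,w\in V\subset C$. $S$ is a fixed $2^n$-dimensional $k$-vector space (spinors) with an algebra isomorphism $C\cong End(S)$; $c\cdot\psi$ denotes the resulting action of $c\in C$ on $\psi\in S$. A spinor norm is a bilinear map $B:S\times S\to k$ with $B(v\cdot\phi,\psi)=B(\phi,v\cdot\psi)$ for all $v\in V$, $\phi,\psi\in S$; a nondegenerate spinor norm $B$ is fixed. An orthonormal basis of $V$ is a basis $x_1,\dots,x_{2n}$ with $g(x_i,x_j)=\pm\delta_{ij}$. $C^2\subset C$ is the span of the products $x_ix_j$, $i<j$, for any orthonormal basis (independent of the choice). The map $\tilde L_2:S\times S\to C^2$ is $$\tilde L_2(\phi,\psi)=\frac12\sum_{i<j}g(x_i,x_i)g(x_j,x_j)B(\phi,x_jx_i\cdot\psi)\,x_ix_j,$$ for any orthonormal basis $x_1,\dots,x_{2n}$ of $V$ (the result does not depend on the choice). A maximal isotropic subspace is an $n$-dimensional subspace of $V$ on which $g$ vanishes. *)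

theory Defs
  imports Complex_Main "HOL-Library.Poly_Mapping"
begin

section \<open>Linear algebra\<close>

definition is_basis_of :: "('k::field \<Rightarrow> 'a::ab_group_add \<Rightarrow> 'a) \<Rightarrow> 'a set \<Rightarrow> 'a set \<Rightarrow> bool"
  where "is_basis_of scale Bs W \<longleftrightarrow> \<not> module.dependent scale Bs \<and> module.span scale Bs = W"

text \<open>The library's \<open>dim\<close> is 0 on infinite-dimensional spaces, hence the following predicate.\<close>

definition has_dimension :: "('k::field \<Rightarrow> 'a::ab_group_add \<Rightarrow> 'a) \<Rightarrow> 'a set \<Rightarrow> nat \<Rightarrow> bool"
  where "has_dimension scale W d \<longleftrightarrow> (\<exists>Bs. finite Bs \<and> card Bs = d \<and> is_basis_of scale Bs W)"

definition is_basis_family ::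
    "('k::field \<Rightarrow> 'a::ab_group_add \<Rightarrow> 'a) \<Rightarrow> (nat \<Rightarrow> 'a) \<Rightarrow> nat \<Rightarrow> 'a set \<Rightarrow> bool"
  where "is_basis_family scale f m W \<longleftrightarrow> inj_on f {1..m} \<and> is_basis_of scale (f ` {1..m}) W"

definition bilinear_form ::
    "('k::field \<Rightarrow> 'a::ab_group_add \<Rightarrow> 'a) \<Rightarrow> ('a \<Rightarrow> 'a \<Rightarrow> 'k) \<Rightarrow> bool"
  where "bilinear_form scale b \<longleftrightarrow>
    (\<forall>x. Vector_Spaces.linear scale (*) (\<lambda>y. b x y)) \<and>
    (\<forall>y. Vector_Spaces.linear scale (*) (\<lambda>x. b x y))"

definition nondegenerate :: "('a::zero \<Rightarrow> 'a \<Rightarrow> 'k::zero) \<Rightarrow> bool"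
  where "nondegenerate b \<longleftrightarrow>
    (\<forall>x. (\<forall>y. b x y = 0) \<longrightarrow> x = 0) \<and> (\<forall>y. (\<forall>x. b x y = 0) \<longrightarrow> y = 0)"

definition isotropic_subspace ::
    "('k::field \<Rightarrow> 'v::ab_group_add \<Rightarrow> 'v) \<Rightarrow> ('v \<Rightarrow> 'v \<Rightarrow> 'k) \<Rightarrow> 'v set \<Rightarrow> bool"
  where "isotropic_subspace scale g W \<longleftrightarrow>
    module.subspace scale W \<and> (\<forall>v\<in>W. \<forall>w\<in>W. g v w = 0)"

definition witt_index ::
    "('k::field \<Rightarrow> 'v::ab_group_add \<Rightarrow> 'v) \<Rightarrow> ('v \<Rightarrow> 'v \<Rightarrow> 'k) \<Rightarrow> nat"
  where "witt_index scale g = Max {d. \<exists>W. isotropic_subspace scale g W \<and> has_dimension scale W d}"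

definition hyperbolic_space ::
    "('k::field \<Rightarrow> 'v::ab_group_add \<Rightarrow> 'v) \<Rightarrow> ('v \<Rightarrow> 'v \<Rightarrow> 'k) \<Rightarrow> nat \<Rightarrow> bool"
  where "hyperbolic_space scale g n \<longleftrightarrow>
    vector_space scale \<and> has_dimension scale UNIV (2 * n) \<and>
    bilinear_form scale g \<and> (\<forall>v w. g v w = g w v) \<and> nondegenerate g \<and>
    witt_index scale g = n"

definition maximal_isotropic ::
    "('k::field \<Rightarrow> 'v::ab_group_add \<Rightarrow> 'v) \<Rightarrow> ('v \<Rightarrow> 'v \<Rightarrow> 'k) \<Rightarrow> nat \<Rightarrow> 'v set \<Rightarrow> bool"
  where "maximal_isotropic scale g n W \<longleftrightarrow>
    isotropic_subspace scale g W \<and> has_dimension scale W n"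

definition direct_sum_decomposition :: "'v::ab_group_add set \<Rightarrow> 'v set \<Rightarrow> bool"
  where "direct_sum_decomposition U W \<longleftrightarrow> U \<inter> W = {0} \<and> (\<forall>v. \<exists>u\<in>U. \<exists>w\<in>W. v = u + w)"

definition orthonormal_basis ::
    "('k::field \<Rightarrow> 'v::ab_group_add \<Rightarrow> 'v) \<Rightarrow> ('v \<Rightarrow> 'v \<Rightarrow> 'k) \<Rightarrow> nat \<Rightarrow> (nat \<Rightarrow> 'v) \<Rightarrow> bool"
  where "orthonormal_basis scale g n x \<longleftrightarrow>
    is_basis_family scale x (2 * n) UNIV \<and>
    (\<forall>i\<in>{1..2*n}. g (x i) (x i) = 1 \<or> g (x i) (x i) = - 1) \<and>
    (\<forall>i\<in>{1..2*n}. \<forall>j\<in>{1..2*n}. i \<noteq> j \<longrightarrow> g (x i) (x j) = 0)"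


section \<open>The Clifford algebra\<close>

text \<open>
  Finitely supported functions on the free monoid over the set \<open>V\<close>, with convolution
  product, form the free associative unital \<open>k\<close>-algebra on the set \<open>V\<close>. Dividing out
  linearity of \<open>V\<close> gives the tensor algebra of the vector space \<open>V\<close>; dividing out
  \<open>vw + wv = 2g(v,w)1\<close> as well gives the Clifford algebra.
\<close>

datatype 'v free_monoid = Free_Word (letters: "'v list")

instantiation free_monoid :: (type) monoid_add
begin

definition zero_free_monoid :: "'a free_monoid"
  where "0 = Free_Word []"

definition plus_free_monoid :: "'a free_monoid \<Rightarrow> 'a free_monoid \<Rightarrow> 'a free_monoid"
  where "u + w = Free_Word (letters u @ letters w)"

instance
  by standard (simp_all add: zero_free_monoid_def plus_free_monoid_def)

end

type_synonym ('v, 'k) free_algebra = "'v free_monoid \<Rightarrow>\<^sub>0 'k"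

definition free_gen :: "'v \<Rightarrow> ('v, 'k::field) free_algebra"
  where "free_gen v = Poly_Mapping.single (Free_Word [v]) 1"

definition free_const :: "'k::field \<Rightarrow> ('v, 'k) free_algebra"
  where "free_const a = Poly_Mapping.single 0 a"

definition clifford_relators ::
    "('k::field \<Rightarrow> 'v::ab_group_add \<Rightarrow> 'v) \<Rightarrow> ('v \<Rightarrow> 'v \<Rightarrow> 'k) \<Rightarrow> ('v, 'k) free_algebra set"
  where "clifford_relators scaleV g =
    {free_gen (v + w) - free_gen v - free_gen w | v w. True} \<union>
    {free_gen (scaleV a v) - free_const a * free_gen v | a v. True} \<union>
    {free_gen v * free_gen w + free_gen w * free_gen v - free_const (2 * g v w) | v w. True}"

inductive_set ideal_generated :: "'a::ring_1 set \<Rightarrow> 'a set" for R :: "'a set"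
  where
    generator: "r \<in> R \<Longrightarrow> r \<in> ideal_generated R"
  | zero: "0 \<in> ideal_generated R"
  | add: "p \<in> ideal_generated R \<Longrightarrow> q \<in> ideal_generated R \<Longrightarrow> p + q \<in> ideal_generated R"
  | mult: "p \<in> ideal_generated R \<Longrightarrow> s * p * t \<in> ideal_generated R"

definition algebra_over :: "('k::field \<Rightarrow> 'c::ring_1 \<Rightarrow> 'c) \<Rightarrow> bool"
  where "algebra_over scale \<longleftrightarrow> vector_space scale \<and>
    (\<forall>a x y. scale a x * y = scale a (x * y) \<and> x * scale a y = scale a (x * y))"

definition free_algebra_eval ::
    "('k::field \<Rightarrow> 'c::ring_1 \<Rightarrow> 'c) \<Rightarrow> ('v \<Rightarrow> 'c) \<Rightarrow> ('v, 'k) free_algebra \<Rightarrow> 'c"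
  where "free_algebra_eval scaleC \<iota> p =
    (\<Sum>u\<in>Poly_Mapping.keys p.
       scaleC (Poly_Mapping.lookup p u) (prod_list (map \<iota> (letters u))))"

text \<open>
  The type \<open>'c\<close> together with \<open>\<iota>\<close> is the Clifford algebra of \<open>(V, g)\<close>: evaluation at
  \<open>\<iota>\<close> identifies \<open>'c\<close> with the quotient of the free algebra by the ideal of relations.
\<close>

definition clifford_algebra ::
    "('k::field \<Rightarrow> 'v::ab_group_add \<Rightarrow> 'v) \<Rightarrow> ('v \<Rightarrow> 'v \<Rightarrow> 'k) \<Rightarrow>
     ('k \<Rightarrow> 'c::ring_1 \<Rightarrow> 'c) \<Rightarrow> ('v \<Rightarrow> 'c) \<Rightarrow> bool"
  where "clifford_algebra scaleV g scaleC \<iota> \<longleftrightarrow>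
    algebra_over scaleC \<and>
    surj (free_algebra_eval scaleC \<iota>) \<and>
    {p. free_algebra_eval scaleC \<iota> p = 0} = ideal_generated (clifford_relators scaleV g)"

definition C2 :: "('k::field \<Rightarrow> 'c::ring_1 \<Rightarrow> 'c) \<Rightarrow> ('v \<Rightarrow> 'c) \<Rightarrow> nat \<Rightarrow> (nat \<Rightarrow> 'v) \<Rightarrow> 'c set"
  where "C2 scaleC \<iota> n x =
    module.span scaleC {\<iota> (x i) * \<iota> (x j) | i j. 1 \<le> i \<and> i < j \<and> j \<le> 2 * n}"


section \<open>Spinors\<close>

definition spinor_representation ::
    "('k::field \<Rightarrow> 'c::ring_1 \<Rightarrow> 'c) \<Rightarrow> ('k \<Rightarrow> 's::ab_group_add \<Rightarrow> 's) \<Rightarrow> nat \<Rightarrow>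
     ('c \<Rightarrow> 's \<Rightarrow> 's) \<Rightarrow> bool"
  where "spinor_representation scaleC scaleS n act \<longleftrightarrow>
    vector_space scaleS \<and> has_dimension scaleS UNIV (2 ^ n) \<and>
    bij_betw act UNIV {f. Vector_Spaces.linear scaleS scaleS f} \<and>
    act 1 = id \<and>
    (\<forall>c d. act (c * d) = act c \<circ> act d) \<and>
    (\<forall>c d. act (c + d) = (\<lambda>\<phi>. act c \<phi> + act d \<phi>)) \<and>
    (\<forall>a c. act (scaleC a c) = (\<lambda>\<phi>. scaleS a (act c \<phi>)))"

definition spinor_norm ::
    "('k::field \<Rightarrow> 's::ab_group_add \<Rightarrow> 's) \<Rightarrow> ('v \<Rightarrow> 'c) \<Rightarrow> ('c \<Rightarrow> 's \<Rightarrow> 's) \<Rightarrow>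
     ('s \<Rightarrow> 's \<Rightarrow> 'k) \<Rightarrow> bool"
  where "spinor_norm scaleS \<iota> act B \<longleftrightarrow>
    bilinear_form scaleS B \<and> (\<forall>v \<phi> \<psi>. B (act (\<iota> v) \<phi>) \<psi> = B \<phi> (act (\<iota> v) \<psi>))"

text \<open>
  \<open>C2\<close> above and \<open>tilde_L2\<close> below do not depend on the orthonormal basis \<open>x\<close> used to
  write them down; results are stated for an arbitrary one. The 2n vectors
  \<open>e\<^sub>a + i\<^sub>a\<close>, \<open>e\<^sub>a - i\<^sub>a\<close> built from bases with \<open>g(e\<^sub>a, i\<^sub>b) = \<delta>\<^sub>a\<^sub>b / 2\<close> of two complementary
  isotropic subspaces show that one exists.
\<close>

definition tilde_L2 ::
    "('v \<Rightarrow> 'v \<Rightarrow> 'k::field) \<Rightarrow> ('k \<Rightarrow> 'c::ring_1 \<Rightarrow> 'c) \<Rightarrow> ('v \<Rightarrow> 'c) \<Rightarrow> ('c \<Rightarrow> 's \<Rightarrow> 's) \<Rightarrow>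
     ('s \<Rightarrow> 's \<Rightarrow> 'k) \<Rightarrow> nat \<Rightarrow> (nat \<Rightarrow> 'v) \<Rightarrow> 's \<Rightarrow> 's \<Rightarrow> 'c"
  where "tilde_L2 g scaleC \<iota> act B n x \<phi> \<psi> =
    scaleC (1 / 2) (\<Sum>(i, j)\<in>{(i, j). 1 \<le> i \<and> i < j \<and> j \<le> 2 * n}.
      scaleC (g (x i) (x i) * g (x j) (x j) * B \<phi> (act (\<iota> (x j) * \<iota> (x i)) \<psi>))
        (\<iota> (x i) * \<iota> (x j)))"

end

theory Submission
  imports Defs
begin

text \<open>
  The operator $\tilde L_2$ is a contraction against the inverse metric. Write
  $[v,w] = vw - wv$ for vectors $v,w$, embedded in the Clifford algebra. Since distinct members
  of an orthonormal basis anticommute, $2 x_j x_k = [x_j,x_k]$ for $j \neq k$, and moving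
  $x_k x_j$ to the other side of the spinor norm, which reverses it, turns $\tilde L_2(\psi_1,\psi_2)$ into
  \[ \frac{1}{16} \sum_{j,k} g(x_j,x_j)\, g(x_k,x_k)\, f([x_j,x_k])\, [x_j,x_k], \qquad
     f(c) = B(c \cdot \psi_1, \psi_2). \]
  The tensor $\sum_j g(x_j,x_j)\, x_j \otimes x_j$ is the inverse of $g$ and therefore equals
  $2 \sum_a (e_a \otimes i_a + i_a \otimes e_a)$, because $g(e_a,i_b) = \delta_{ab}/2$; this is
  \<open>contraction_frames\<close>. Substituting it for both indices, \<open>bivector_contraction_frames\<close> gives four
  double sums over $a$ and $b$; the two with one $e$ and one $i$ in each bracket agree after
  exchanging $a$ and $b$. For $a \neq b$ the brackets $[e_a,e_b]$, $[i_a,i_b]$, $[e_a,i_b]$ are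
  again twice the products, and the diagonal survives only in the mixed sum. This yields the
  formula, \<open>product_contraction_frames\<close>, for an arbitrary linear functional $f$ on the Clifford
  algebra.

  For the basis statement, the brackets of any spanning set of $V$ span the same space of
  bivectors, so the orthonormal products and the frame products both span $C^2$.
  Independence follows from a system of dual linear maps: for fixed vectors $u,t$ the map that
  takes a commutator with $u$ and then an anticommutator with $t$ sends $vw$ to
  $4\,(g(w,u) g(v,t) - g(v,u) g(w,t))$, and choosing $u,t$ in the dual frame isolates one basis
  element at a time. These scalars are detected because $1 \neq 0$ in an algebra that acts on a nonzero
  spinor space.
\<close>

section \<open>Preliminaries\<close>

text \<open>
  A biorthogonal system of linear maps certifies independence without any indexing of the set, so
  coincidences between differently indexed products need no separate treatment.
\<close>

lemma independent_if_separated: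
  fixes scale :: "'k::field \<Rightarrow> 'c::ab_group_add \<Rightarrow> 'c"
  assumes "vector_space scale"
    and sep: "\<And>x. x \<in> X \<Longrightarrow>
      \<exists>f. Vector_Spaces.linear scale scale f \<and> f x \<noteq> 0 \<and> (\<forall>y\<in>X. y \<noteq> x \<longrightarrow> f y = 0)"
  shows "\<not> module.dependent scale X"
proof
  interpret vector_space scale by fact
  interpret vector_space_pair scale scale by unfold_locales
  assume "dependent X"
  then obtain x where x: "x \<in> X" "x \<in> span (X - {x})"
    unfolding dependent_def by blast
  with sep obtain f where f: "Vector_Spaces.linear scale scale f" "f x \<noteq> 0"
    "\<forall>y\<in>X. y \<noteq> x \<longrightarrow> f y = 0"
    by meson
  have "f x = 0"
    by (rule linear_eq_0_on_span[OF f(1) _ x(2)]) (use f(3) in auto)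
  with f(2) show False by contradiction
qed

lemmas linear_map_sum = module_hom.sum[OF Vector_Spaces.linear.axioms(3)]
lemmas linear_map_scale = module_hom.scale[OF Vector_Spaces.linear.axioms(3)]
lemmas linear_map_neg = module_hom.neg[OF Vector_Spaces.linear.axioms(3)]

lemma sum_square_eq_twice_sum_less:
  fixes F :: "nat \<Rightarrow> nat \<Rightarrow> 'c::ab_group_add"
  assumes sym: "\<And>j k. F j k = F k j" and diag: "\<And>j. F j j = 0"
  shows "(\<Sum>j\<in>{1..m}. \<Sum>k\<in>{1..m}. F j k)
    = (\<Sum>(j, k)\<in>{(j, k). 1 \<le> j \<and> j < k \<and> k \<le> m}. F j k)
      + (\<Sum>(j, k)\<in>{(j, k). 1 \<le> j \<and> j < k \<and> k \<le> m}. F j k)"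
proof -
  let ?L = "{(j, k). 1 \<le> j \<and> j < k \<and> k \<le> m}"
  let ?G = "{(j, k). 1 \<le> k \<and> k < j \<and> j \<le> m}"
  let ?D = "{(j, k). 1 \<le> j \<and> j = k \<and> k \<le> m}"
  have fin: "finite ?L" "finite ?G" "finite ?D"
    by (rule finite_subset[of _ "{1..m} \<times> {1..m}"]; auto)+
  have "(\<Sum>j\<in>{1..m}. \<Sum>k\<in>{1..m}. F j k) = (\<Sum>(j, k)\<in>{1..m} \<times> {1..m}. F j k)"
    by (simp add: sum.cartesian_product)
  also have "{1..m} \<times> {1..m} = (?L \<union> ?G) \<union> ?D"
    by auto
  also have "(\<Sum>(j, k)\<in>\<dots>. F j k)
      = (\<Sum>(j, k)\<in>?L. F j k) + (\<Sum>(j, k)\<in>?G. F j k) + (\<Sum>(j, k)\<in>?D. F j k)"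
    by (subst sum.union_disjoint, use fin in auto)+
  also have "(\<Sum>(j, k)\<in>?D. F j k) = 0"
    by (rule sum.neutral) (auto simp: diag)
  also have "(\<Sum>(j, k)\<in>?G. F j k) = (\<Sum>(j, k)\<in>?L. F j k)"
    by (rule sum.reindex_bij_witness[of _ prod.swap prod.swap]) (auto simp: sym)
  finally show ?thesis by simp
qed

section \<open>Evaluation on the free algebra\<close>

lemma free_algebra_eval_superset:
  assumes "vector_space scaleC" and "finite K" and "Poly_Mapping.keys p \<subseteq> K"
  shows "free_algebra_eval scaleC \<iota> p =
    (\<Sum>u\<in>K. scaleC (Poly_Mapping.lookup p u) (prod_list (map \<iota> (letters u))))"
proof -
  interpret vector_space scaleC by fact
  show ?thesis
    unfolding free_algebra_eval_def
    by (rule sum.mono_neutral_left) (use assms in \<open>auto simp: in_keys_iff\<close>)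
qed

lemma free_algebra_eval_add:
  assumes "vector_space scaleC"
  shows "free_algebra_eval scaleC \<iota> (p + q)
    = free_algebra_eval scaleC \<iota> p + free_algebra_eval scaleC \<iota> q"
proof -
  interpret vector_space scaleC by fact
  let ?K = "Poly_Mapping.keys p \<union> Poly_Mapping.keys q"
  have "Poly_Mapping.keys (p + q) \<subseteq> ?K" by (rule Poly_Mapping.keys_add)
  then show ?thesis
    by (simp add: free_algebra_eval_superset[OF assms, of ?K] lookup_add scale_left_distrib
        sum.distrib)
qed

lemma free_algebra_eval_diff:
  assumes "vector_space scaleC"
  shows "free_algebra_eval scaleC \<iota> (p - q)
    = free_algebra_eval scaleC \<iota> p - free_algebra_eval scaleC \<iota> q"
  using free_algebra_eval_add[OF assms, of \<iota> "p - q" q] by (simp add: algebra_simps)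

lemma free_algebra_eval_single:
  assumes "vector_space scaleC"
  shows "free_algebra_eval scaleC \<iota> (Poly_Mapping.single u a)
    = scaleC a (prod_list (map \<iota> (letters u)))"
proof -
  interpret vector_space scaleC by fact
  show ?thesis
    by (subst free_algebra_eval_superset[OF assms, of "{u}"]) auto
qed

section \<open>Clifford maps\<close>

locale clifford_map =
  V: vector_space scaleV + C: vector_space scaleC
  for scaleV :: "'k::field \<Rightarrow> 'v::ab_group_add \<Rightarrow> 'v" (infixr \<open>*\<^sub>V\<close> 75)
    and scaleC :: "'k \<Rightarrow> 'c::ring_1 \<Rightarrow> 'c" (infixr \<open>*\<^sub>C\<close> 75) +
  fixes g :: "'v \<Rightarrow> 'v \<Rightarrow> 'k" and \<iota> :: "'v \<Rightarrow> 'c"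
  assumes two_nonzero: "(2::'k) \<noteq> 0"
    and form_sym: "g v w = g w v"
    and form_linear: "Vector_Spaces.linear scaleV (*) (g v)"
    and scale_mult_left: "(r *\<^sub>C c) * d = r *\<^sub>C (c * d)"
    and scale_mult_right: "c * (r *\<^sub>C d) = r *\<^sub>C (c * d)"
    and iota_linear: "Vector_Spaces.linear scaleV scaleC \<iota>"
    and anticommutator: "\<iota> v * \<iota> w + \<iota> w * \<iota> v = (2 * g v w) *\<^sub>C 1"
begin

sublocale VV: vector_space_pair scaleV scaleV by unfold_locales
sublocale VC: vector_space_pair scaleV scaleC by unfold_locales
sublocale CC: vector_space_pair scaleC scaleC by unfold_locales

lemma four_nonzero: "(4::'k) \<noteq> 0"
proof
  assume "(4::'k) = 0"
  then have "(2::'k) * 2 = 0" by simp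
  then show False using two_nonzero by (auto simp only: mult_eq_0_iff)
qed

lemma two_scale: "2 *\<^sub>C c = c + c"
  using C.scale_left_distrib[of 1 1 c] by simp

lemma eighths: "1 / 8 * 2 = (1 / 4 :: 'k)" "1 / 8 * 4 = (1 / 2 :: 'k)" "1 / 4 * 2 = (1 / 2 :: 'k)"
    "1 / 2 * (1 / 2) = (1 / 4 :: 'k)"
proof -
  have "(8::'k) \<noteq> 0"
  proof
    assume "(8::'k) = 0"
    then have "(2::'k) * 4 = 0" by simp
    then show False using two_nonzero four_nonzero by (auto simp only: mult_eq_0_iff)
  qed
  with two_nonzero four_nonzero
  show "1 / 8 * 2 = (1 / 4 :: 'k)" "1 / 8 * 4 = (1 / 2 :: 'k)" "1 / 4 * 2 = (1 / 2 :: 'k)"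
    "1 / 2 * (1 / 2) = (1 / 4 :: 'k)"
    by (simp_all add: field_simps)
qed

lemma iota_add: "\<iota> (v + w) = \<iota> v + \<iota> w"
  and iota_scale: "\<iota> (r *\<^sub>V v) = r *\<^sub>C \<iota> v"
  using iota_linear by (simp_all add: Vector_Spaces.linear_iff)

lemma form_add_right: "g v (w + u) = g v w + g v u"
  and form_scale_right: "g v (r *\<^sub>V w) = r * g v w"
  using form_linear by (simp_all add: Vector_Spaces.linear_iff)

lemma form_add_left: "g (v + w) u = g v u + g w u"
  and form_scale_left: "g (r *\<^sub>V v) w = r * g v w"
  by (metis form_sym form_add_right) (metis form_sym form_scale_right)

text \<open>
  Commutation with a product of two vectors preserves the space of vectors: this is the
  infinitesimal orthogonal action. It comes from moving $u$ past $w$ and then past $v$.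
\<close>

lemma commutator_product:
  "\<iota> v * \<iota> w * \<iota> u - \<iota> u * (\<iota> v * \<iota> w) = (2 * g w u) *\<^sub>C \<iota> v - (2 * g v u) *\<^sub>C \<iota> w"
proof -
  have "\<iota> v * \<iota> w * \<iota> u = \<iota> v * (\<iota> w * \<iota> u + \<iota> u * \<iota> w) - (\<iota> v * \<iota> u + \<iota> u * \<iota> v) * \<iota> w
      + \<iota> u * (\<iota> v * \<iota> w)"
    by (simp add: algebra_simps)
  then show ?thesis
    by (simp add: anticommutator scale_mult_left scale_mult_right)
qed

text \<open>
  A linear map that reads off coefficients of bivectors: the commutator with $u$ lowers the degree
  from two to one, the anticommutator with $t$ from one to zero. Its values stay in the algebra,
  as multiples of $1$, so no projection onto scalars has to be constructed.
\<close>

definition probe :: "'v \<Rightarrow> 'v \<Rightarrow> 'c \<Rightarrow> 'c" where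
  "probe u t c = (c * \<iota> u - \<iota> u * c) * \<iota> t + \<iota> t * (c * \<iota> u - \<iota> u * c)"

lemma probe_linear: "Vector_Spaces.linear scaleC scaleC (probe u t)"
  by (simp add: Vector_Spaces.linear_iff C.vector_space_axioms probe_def scale_mult_left
      scale_mult_right C.scale_right_distrib C.scale_right_diff_distrib algebra_simps)

lemma probe_diff: "probe u t (c - d) = probe u t c - probe u t d"
  by (rule CC.linear_diff[OF probe_linear])

lemma probe_product:
  "probe u t (\<iota> v * \<iota> w) = (4 * (g w u * g v t - g v u * g w t)) *\<^sub>C 1"
proof -
  have "probe u t (\<iota> v * \<iota> w)
      = (2 * g w u) *\<^sub>C (\<iota> v * \<iota> t + \<iota> t * \<iota> v) - (2 * g v u) *\<^sub>C (\<iota> w * \<iota> t + \<iota> t * \<iota> w)"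
    unfolding probe_def commutator_product
    by (simp add: scale_mult_left scale_mult_right C.scale_right_distrib algebra_simps)
  also have "\<dots> = (4 * (g w u * g v t - g v u * g w t)) *\<^sub>C 1"
    unfolding anticommutator by (simp add: algebra_simps)
  finally show ?thesis .
qed

definition bivector :: "'v \<Rightarrow> 'v \<Rightarrow> 'c" where
  "bivector v w = \<iota> v * \<iota> w - \<iota> w * \<iota> v"

lemma bivector_swap: "bivector v w = - bivector w v"
  by (simp add: bivector_def)

lemma bivector_self [simp]: "bivector v v = 0"
  by (simp add: bivector_def)

lemma bivector_linear_left: "Vector_Spaces.linear scaleV scaleC (\<lambda>v. bivector v w)"
  and bivector_linear_right: "Vector_Spaces.linear scaleV scaleC (bivector v)"
  by (simp_all add: Vector_Spaces.linear_iff V.vector_space_axioms C.vector_space_axioms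
      bivector_def iota_add iota_scale scale_mult_left scale_mult_right
      C.scale_right_diff_distrib algebra_simps)

lemma bivector_orthogonal: "g v w = 0 \<Longrightarrow> bivector v w = 2 *\<^sub>C (\<iota> v * \<iota> w)"
  using anticommutator[of v w] C.scale_left_distrib[of 1 1 "\<iota> v * \<iota> w"]
  by (simp add: bivector_def eq_neg_iff_add_eq_0 algebra_simps)

lemma half_bivector: "g v w = 0 \<Longrightarrow> \<iota> v * \<iota> w = (1 / 2) *\<^sub>C bivector v w"
  using two_nonzero by (simp add: bivector_orthogonal)

text \<open>
  Spanning questions about brackets reduce to generators: bilinearity allows one argument to be
  replaced at a time.
\<close>

lemma bivector_in_subspace:
  assumes "V.span U = UNIV" and M: "C.subspace M"
    and gen: "\<And>u u'. u \<in> U \<Longrightarrow> u' \<in> U \<Longrightarrow> bivector u u' \<in> M"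
  shows "bivector v w \<in> M"
proof -
  have step: "bivector u w' \<in> M" if "u \<in> U" for u w'
    using VC.linear_subspace_vimage[OF bivector_linear_right M, of u]
      V.span_minimal[of U "bivector u -` M"] gen[OF that] assms(1) by auto
  show ?thesis
    using VC.linear_subspace_vimage[OF bivector_linear_left M, of w]
      V.span_minimal[of U "(\<lambda>v. bivector v w) -` M"] step assms(1) by auto
qed

text \<open>
  The coefficient of $x_j$ would be $g(x_j,v)/g(x_j,x_j)$; the quotient is a product because
  $g(x_j,x_j) = \pm 1$.
\<close>

lemma orthonormal_expansion:
  assumes x: "orthonormal_basis scaleV g n x"
  shows "(\<Sum>j\<in>{1..2*n}. (g (x j) (x j) * g (x j) v) *\<^sub>V x j) = v"
proof (rule VV.linear_eq_on)
  show "Vector_Spaces.linear scaleV scaleV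
      (\<lambda>v. \<Sum>j\<in>{1..2*n}. (g (x j) (x j) * g (x j) v) *\<^sub>V x j)"
    by (simp add: Vector_Spaces.linear_iff V.vector_space_axioms form_add_right
        form_scale_right V.scale_left_distrib V.scale_sum_right sum.distrib algebra_simps)
  show "v \<in> V.span (x ` {1..2*n})"
    using x by (simp add: orthonormal_basis_def is_basis_family_def is_basis_of_def)
  fix b assume "b \<in> x ` {1..2*n}"
  then obtain k where k: "k \<in> {1..2*n}" "b = x k" by blast
  have "(g (x j) (x j) * g (x j) b) *\<^sub>V x j = (if j = k then x k else 0)"
    if "j \<in> {1..2*n}" for j
    using x k that unfolding orthonormal_basis_def by fastforce
  then show "(\<Sum>j\<in>{1..2*n}. (g (x j) (x j) * g (x j) b) *\<^sub>V x j) = b"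
    using k by simp
qed (rule V.linear_ident)

text \<open>
  This is why $C^2$ does not depend on the orthonormal basis; it also removes the order $j < k$
  of the indices from the description of $C^2$.
\<close>

lemma C2_eq_span_bivectors:
  assumes x: "orthonormal_basis scaleV g n x"
  shows "C2 scaleC \<iota> n x = C.span {bivector v w | v w. True}"
proof -
  let ?X = "{\<iota> (x i) * \<iota> (x j) | i j. 1 \<le> i \<and> i < j \<and> j \<le> 2 * n}"
  have orth: "g (x j) (x k) = 0" if "j \<in> {1..2*n}" "k \<in> {1..2*n}" "j \<noteq> k" for j k
    using x that by (simp add: orthonormal_basis_def)
  have less: "bivector (x j) (x k) \<in> C.span ?X" if "1 \<le> j" "j < k" "k \<le> 2 * n" for j k
  proof -
    have "\<iota> (x j) * \<iota> (x k) \<in> C.span ?X"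
      by (rule C.span_base) (use that in blast)
    then show ?thesis
      using orth[of j k] that by (simp add: bivector_orthogonal C.span_scale)
  qed
  have all: "bivector v w \<in> C.span ?X" for v w
  proof (rule bivector_in_subspace)
    show "V.span (x ` {1..2*n}) = UNIV"
      using x by (simp add: orthonormal_basis_def is_basis_family_def is_basis_of_def)
    fix u u' assume "u \<in> x ` {1..2*n}" "u' \<in> x ` {1..2*n}"
    then obtain j k where jk: "u = x j" "u' = x k" "j \<in> {1..2*n}" "k \<in> {1..2*n}" by blast
    consider "j < k" | "j = k" | "k < j" by linarith
    then show "bivector u u' \<in> C.span ?X"
    proof cases
      case 3
      then show ?thesis
        using less[of k j] jk bivector_swap[of u u'] by (simp add: C.span_neg)
    qed (use jk less[of j k] in \<open>auto simp: C.span_zero\<close>)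
  qed (rule C.subspace_span)
  have "\<iota> (x j) * \<iota> (x k) \<in> C.span {bivector v w | v w. True}"
    if "1 \<le> j" "j < k" "k \<le> 2 * n" for j k
  proof -
    have "bivector (x j) (x k) \<in> C.span {bivector v w | v w. True}"
      by (rule C.span_base) blast
    then show ?thesis
      using half_bivector[OF orth[of j k]] that by (simp add: C.span_scale)
  qed
  then show ?thesis
    unfolding C2_def C.span_eq using all by auto
qed

end

section \<open>Dual isotropic frames\<close>

locale clifford_map_isotropic_frames = clifford_map scaleV scaleC g \<iota>
  for scaleV :: "'k::field \<Rightarrow> 'v::ab_group_add \<Rightarrow> 'v" (infixr \<open>*\<^sub>V\<close> 75)
    and scaleC :: "'k \<Rightarrow> 'c::ring_1 \<Rightarrow> 'c" (infixr \<open>*\<^sub>C\<close> 75)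
    and g :: "'v \<Rightarrow> 'v \<Rightarrow> 'k" and \<iota> :: "'v \<Rightarrow> 'c" +
  fixes n :: nat and e i :: "nat \<Rightarrow> 'v"
  assumes e_isotropic: "a \<in> {1..n} \<Longrightarrow> b \<in> {1..n} \<Longrightarrow> g (e a) (e b) = 0"
    and i_isotropic: "a \<in> {1..n} \<Longrightarrow> b \<in> {1..n} \<Longrightarrow> g (i a) (i b) = 0"
    and e_i_dual: "a \<in> {1..n} \<Longrightarrow> b \<in> {1..n} \<Longrightarrow> g (e a) (i b) = (if a = b then 1 / 2 else 0)"
    and frames_span: "V.span (e ` {1..n} \<union> i ` {1..n}) = UNIV"
begin

lemma i_e_dual: "a \<in> {1..n} \<Longrightarrow> b \<in> {1..n} \<Longrightarrow> g (i a) (e b) = (if a = b then 1 / 2 else 0)"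
  using e_i_dual[of b a] form_sym[of "i a" "e b"] by auto

text \<open>
  The frames $e$ and $2i$ are dual under $g$, hence the coefficients with factor two.
\<close>

lemma frames_expansion:
  "2 *\<^sub>V (\<Sum>a\<in>{1..n}. g v (i a) *\<^sub>V e a + g v (e a) *\<^sub>V i a) = v"
proof (rule VV.linear_eq_on)
  show "Vector_Spaces.linear scaleV scaleV
      (\<lambda>v. 2 *\<^sub>V (\<Sum>a\<in>{1..n}. g v (i a) *\<^sub>V e a + g v (e a) *\<^sub>V i a))"
    by (simp add: Vector_Spaces.linear_iff V.vector_space_axioms form_add_left
        form_scale_left V.scale_left_distrib V.scale_right_distrib V.scale_sum_right
        sum.distrib algebra_simps)
  show "v \<in> V.span (e ` {1..n} \<union> i ` {1..n})"
    using frames_span by simp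
  fix b assume "b \<in> e ` {1..n} \<union> i ` {1..n}"
  then consider c where "c \<in> {1..n}" "b = e c" | c where "c \<in> {1..n}" "b = i c" by blast
  then show "2 *\<^sub>V (\<Sum>a\<in>{1..n}. g b (i a) *\<^sub>V e a + g b (e a) *\<^sub>V i a) = b"
  proof cases
    case 1
    then have "(\<Sum>a\<in>{1..n}. g b (i a) *\<^sub>V e a + g b (e a) *\<^sub>V i a)
        = (\<Sum>a\<in>{1..n}. if c = a then (1 / 2) *\<^sub>V e a else 0)"
      by (intro sum.cong) (auto simp: e_isotropic e_i_dual)
    then show ?thesis using 1 two_nonzero by simp
  next
    case 2
    then have "(\<Sum>a\<in>{1..n}. g b (i a) *\<^sub>V e a + g b (e a) *\<^sub>V i a)
        = (\<Sum>a\<in>{1..n}. if c = a then (1 / 2) *\<^sub>V i a else 0)"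
      by (intro sum.cong) (auto simp: i_isotropic i_e_dual)
    then show ?thesis using 2 two_nonzero by simp
  qed
qed (rule V.linear_ident)

text \<open>
  Both sides contract $\phi \otimes L$ with the inverse of $g$. Expanding $L(x_j)$ in the isotropic
  frames leaves sums $\sum_j g(x_j,x_j)\, g(x_j,v)\, \phi(x_j)$ with $v$ in the frames, and these are
  $\phi(v)$ by the orthonormal expansion.
\<close>

lemma contraction_frames:
  assumes x: "orthonormal_basis scaleV g n x"
    and \<phi>: "Vector_Spaces.linear scaleV (*) \<phi>" and L: "Vector_Spaces.linear scaleV scaleC L"
  shows "(\<Sum>j\<in>{1..2*n}. (g (x j) (x j) * \<phi> (x j)) *\<^sub>C L (x j))
    = 2 *\<^sub>C (\<Sum>a\<in>{1..n}. \<phi> (e a) *\<^sub>C L (i a) + \<phi> (i a) *\<^sub>C L (e a))"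
proof -
  interpret L: Vector_Spaces.linear scaleV scaleC L by (fact L)
  have resolve: "(\<Sum>j\<in>{1..2*n}. g (x j) (x j) * \<phi> (x j) * g (x j) v) = \<phi> v" for v
    using arg_cong[OF orthonormal_expansion[OF x, of v], of \<phi>]
    by (simp add: linear_map_sum[OF \<phi>] linear_map_scale[OF \<phi>] mult_ac)
  have L_x: "L v = 2 *\<^sub>C (\<Sum>a\<in>{1..n}. g v (i a) *\<^sub>C L (e a) + g v (e a) *\<^sub>C L (i a))" for v
    using arg_cong[OF frames_expansion[of v], of L]
    by (simp add: L.sum L.scale L.add)
  have "(\<Sum>j\<in>{1..2*n}. (g (x j) (x j) * \<phi> (x j)) *\<^sub>C L (x j))
      = (\<Sum>j\<in>{1..2*n}. \<Sum>a\<in>{1..n}.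
          2 *\<^sub>C ((g (x j) (x j) * \<phi> (x j) * g (x j) (i a)) *\<^sub>C L (e a)
               + (g (x j) (x j) * \<phi> (x j) * g (x j) (e a)) *\<^sub>C L (i a)))"
    by (simp add: L_x[of "x _"] C.scale_sum_right C.scale_right_distrib mult_ac)
  also have "\<dots> = (\<Sum>a\<in>{1..n}. \<Sum>j\<in>{1..2*n}.
          2 *\<^sub>C ((g (x j) (x j) * \<phi> (x j) * g (x j) (i a)) *\<^sub>C L (e a)
               + (g (x j) (x j) * \<phi> (x j) * g (x j) (e a)) *\<^sub>C L (i a)))"
    by (rule sum.swap)
  also have "\<dots> = (\<Sum>a\<in>{1..n}. 2 *\<^sub>C (\<phi> (i a) *\<^sub>C L (e a) + \<phi> (e a) *\<^sub>C L (i a)))"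
    by (simp add: sum.distrib resolve del: One_nat_def
        flip: C.scale_sum_right C.scale_sum_left)
  finally show ?thesis
    by (simp add: C.scale_sum_right add.commute)
qed

text \<open>
  The mixed elements have to be brackets: the product $e_a i_a$ differs from $[e_a,i_a]/2$ by a
  scalar and so is not a bivector. The probes with $u,t$ dual to the factors separate the three
  families as well as their members, because $g$ vanishes on each frame.
\<close>

lemma frame_products_basis:
  assumes one: "(1::'c) \<noteq> 0" and x: "orthonormal_basis scaleV g n x"
  shows "is_basis_of scaleC
      ({\<iota> (e a) * \<iota> (e b) | a b. 1 \<le> a \<and> a < b \<and> b \<le> n}
        \<union> {\<iota> (i a) * \<iota> (i b) | a b. 1 \<le> a \<and> a < b \<and> b \<le> n}
        \<union> {\<iota> (e a) * \<iota> (i b) - \<iota> (i b) * \<iota> (e a) | a b. a \<in> {1..n} \<and> b \<in> {1..n}})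
      (C2 scaleC \<iota> n x)"
    (is "is_basis_of scaleC (?E \<union> ?I \<union> ?M) _")
proof -
  note duality = e_isotropic i_isotropic e_i_dual i_e_dual
  have two_C: "(2::'c) \<noteq> 0"
  proof
    assume "(2::'c) = 0"
    then have "2 *\<^sub>C (1::'c) = 0"
      by (simp add: two_scale)
    then show False using one two_nonzero by simp
  qed
  have "C.independent (?E \<union> ?I \<union> ?M)"
  proof (rule independent_if_separated[OF C.vector_space_axioms])
    fix y assume "y \<in> ?E \<union> ?I \<union> ?M"
    then consider
        (E) a b where "1 \<le> a" "a < b" "b \<le> n" "y = \<iota> (e a) * \<iota> (e b)"
      | (I) a b where "1 \<le> a" "a < b" "b \<le> n" "y = \<iota> (i a) * \<iota> (i b)"
      | (M) a b where "a \<in> {1..n}" "b \<in> {1..n}" "y = \<iota> (e a) * \<iota> (i b) - \<iota> (i b) * \<iota> (e a)"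
      by blast
    then show "\<exists>f. Vector_Spaces.linear scaleC scaleC f \<and> f y \<noteq> 0
        \<and> (\<forall>z\<in>?E \<union> ?I \<union> ?M. z \<noteq> y \<longrightarrow> f z = 0)"
    proof cases
      \<comment> \<open>Each probe uses the vectors dual to the factors of the element to be isolated.
        The condition \<open>a < b\<close> excludes the reversed pair, on which it would take the value \<open>-1\<close>.\<close>
      case E
      then show ?thesis
        using one two_nonzero
        by (intro exI[of _ "probe (i b) (i a)"])
          (auto simp: probe_linear probe_product probe_diff duality four_nonzero)
    next
      case I
      then show ?thesis
        using one two_nonzero
        by (intro exI[of _ "probe (e b) (e a)"])
          (auto simp: probe_linear probe_product probe_diff duality four_nonzero)
    next
      case M
      then show ?thesis
        using one two_nonzero two_C
        by (intro exI[of _ "probe (e b) (i a)"])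
          (auto simp: probe_linear probe_product probe_diff duality four_nonzero
             simp flip: C.scale_left_diff_distrib)
    qed
  qed
  moreover have "C.span (?E \<union> ?I \<union> ?M) = C.span {bivector v w | v w. True}"
    unfolding C.span_eq
  proof
    have biv: "bivector v w \<in> C.span {bivector v w | v w. True}" for v w
      by (rule C.span_base) blast
    have "?E \<subseteq> C.span {bivector v w | v w. True}" "?I \<subseteq> C.span {bivector v w | v w. True}"
      by (auto simp: half_bivector e_isotropic i_isotropic
          intro!: C.span_scale biv[simplified])
    moreover have "?M \<subseteq> C.span {bivector v w | v w. True}"
      using biv unfolding bivector_def by blast
    ultimately show "?E \<union> ?I \<union> ?M \<subseteq> C.span {bivector v w | v w. True}"
      by (intro Un_least)
    define T where "T = C.span (?E \<union> ?I \<union> ?M)"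
    have T: "C.subspace T"
      unfolding T_def by (rule C.subspace_span)
    have gen: "y \<in> T" if "y \<in> ?E \<union> ?I \<union> ?M" for y
      unfolding T_def using that by (rule C.span_base)
    have neg: "bivector w v \<in> T" if "bivector v w \<in> T" for v w
      using C.subspace_neg[OF T that] by (simp add: bivector_swap[of w v])
    have less: "bivector (e a) (e b) \<in> T" "bivector (i a) (i b) \<in> T"
      if "1 \<le> a" "a < b" "b \<le> n" for a b
    proof -
      have "\<iota> (e a) * \<iota> (e b) \<in> T" "\<iota> (i a) * \<iota> (i b) \<in> T"
        by (rule gen, use that in blast)+
      then show "bivector (e a) (e b) \<in> T" "bivector (i a) (i b) \<in> T"
        using that by (simp_all add: bivector_orthogonal e_isotropic i_isotropic C.subspace_scale[OF T])
    qed
    have same: "bivector (e a) (e b) \<in> T" "bivector (i a) (i b) \<in> T"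
      if "a \<in> {1..n}" "b \<in> {1..n}" for a b
      using that less[of a b] less[of b a] neg[of "e b" "e a"] neg[of "i b" "i a"]
        C.subspace_0[OF T]
      by (cases a b rule: linorder_cases; simp)+
    have mixed: "bivector (e a) (i b) \<in> T" if "a \<in> {1..n}" "b \<in> {1..n}" for a b
      unfolding bivector_def by (rule gen) (use that in blast)
    have "bivector v w \<in> T" for v w
    proof (rule bivector_in_subspace[OF frames_span T])
      fix u u' assume "u \<in> e ` {1..n} \<union> i ` {1..n}" "u' \<in> e ` {1..n} \<union> i ` {1..n}"
      then show "bivector u u' \<in> T"
        using same mixed neg by blast
    qed
    then show "{bivector v w | v w. True} \<subseteq> C.span (?E \<union> ?I \<union> ?M)"
      unfolding T_def by blast
  qed
  ultimately show ?thesis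
    by (simp add: is_basis_of_def C2_eq_span_bivectors[OF x])
qed

text \<open>
  One contraction for each of the two indices. The first contributes $(e,i)$ and $(i,e)$ in the first
  slots of the two brackets, the second likewise in the second slots. Antisymmetry of both
  brackets identifies the two mixed terms, which accounts for the factor two.
\<close>

lemma bivector_contraction_frames:
  assumes x: "orthonormal_basis scaleV g n x" and f: "Vector_Spaces.linear scaleC (*) f"
  shows "(\<Sum>j\<in>{1..2*n}. \<Sum>k\<in>{1..2*n}.
      (g (x j) (x j) * g (x k) (x k) * f (bivector (x j) (x k))) *\<^sub>C bivector (x j) (x k))
    = 4 *\<^sub>C (\<Sum>a\<in>{1..n}. \<Sum>b\<in>{1..n}.
        f (bivector (e a) (e b)) *\<^sub>C bivector (i a) (i b)
      + f (bivector (i a) (i b)) *\<^sub>C bivector (e a) (e b)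
      + 2 *\<^sub>C (f (bivector (e a) (i b)) *\<^sub>C bivector (i a) (e b)))"
proof -
  have f_left: "Vector_Spaces.linear scaleV (*) (\<lambda>v. f (bivector v w))" for w
    using Vector_Spaces.linear_compose[OF bivector_linear_left f] by (simp add: comp_def)
  have f_right: "Vector_Spaces.linear scaleV (*) (\<lambda>v. f (bivector w v))" for w
    using Vector_Spaces.linear_compose[OF bivector_linear_right f] by (simp add: comp_def)
  let ?\<epsilon> = "\<lambda>j. g (x j) (x j)"
  let ?T = "\<lambda>v w v' w'. f (bivector v w) *\<^sub>C bivector v' w'"
  define J where "J = {1..2*n}"
  note contr = contraction_frames[OF x, folded J_def]
  have "(\<Sum>j\<in>J. \<Sum>k\<in>J.
      (?\<epsilon> j * ?\<epsilon> k * f (bivector (x j) (x k))) *\<^sub>C bivector (x j) (x k))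
    = (\<Sum>k\<in>J. ?\<epsilon> k *\<^sub>C (\<Sum>j\<in>J.
      (?\<epsilon> j * f (bivector (x j) (x k))) *\<^sub>C bivector (x j) (x k)))"
    by (subst sum.swap) (simp add: C.scale_sum_right mult_ac)
  also have "\<dots> = (\<Sum>k\<in>J. ?\<epsilon> k *\<^sub>C (2 *\<^sub>C (\<Sum>a\<in>{1..n}.
      ?T (e a) (x k) (i a) (x k) + ?T (i a) (x k) (e a) (x k))))"
    by (simp add: contr[OF f_left bivector_linear_left] )
  also have "\<dots> = 2 *\<^sub>C (\<Sum>a\<in>{1..n}.
      (\<Sum>k\<in>J. (?\<epsilon> k * f (bivector (e a) (x k))) *\<^sub>C bivector (i a) (x k))
      + (\<Sum>k\<in>J. (?\<epsilon> k * f (bivector (i a) (x k))) *\<^sub>C bivector (e a) (x k)))"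
    by (simp add: C.scale_sum_right C.scale_right_distrib sum.distrib mult_ac del: One_nat_def)
      (simp only: sum.swap[where A = J and B = "{1..n}"])
  also have "\<dots> = 4 *\<^sub>C (\<Sum>a\<in>{1..n}. \<Sum>b\<in>{1..n}.
      ?T (e a) (e b) (i a) (i b) + ?T (i a) (i b) (e a) (e b)
      + ?T (e a) (i b) (i a) (e b) + ?T (i a) (e b) (e a) (i b))"
    by (simp add: contr[OF f_right bivector_linear_right]  add: C.scale_sum_right
        C.scale_right_distrib sum.distrib algebra_simps)
  also have "(\<Sum>a\<in>{1..n}. \<Sum>b\<in>{1..n}.
      ?T (e a) (e b) (i a) (i b) + ?T (i a) (i b) (e a) (e b)
      + ?T (e a) (i b) (i a) (e b) + ?T (i a) (e b) (e a) (i b))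
    = (\<Sum>a\<in>{1..n}. \<Sum>b\<in>{1..n}. ?T (e a) (e b) (i a) (i b))
    + (\<Sum>a\<in>{1..n}. \<Sum>b\<in>{1..n}. ?T (i a) (i b) (e a) (e b))
    + (\<Sum>a\<in>{1..n}. \<Sum>b\<in>{1..n}. ?T (e a) (i b) (i a) (e b))
    + (\<Sum>a\<in>{1..n}. \<Sum>b\<in>{1..n}. ?T (i a) (e b) (e a) (i b))"
    by (simp add: sum.distrib)
  also have "(\<Sum>a\<in>{1..n}. \<Sum>b\<in>{1..n}. ?T (i a) (e b) (e a) (i b))
    = (\<Sum>a\<in>{1..n}. \<Sum>b\<in>{1..n}. ?T (e a) (i b) (i a) (e b))"
    by (subst sum.swap) (simp add: bivector_swap[of "i _" "e _"] linear_map_neg[OF f] C.scale_minus_left)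
  finally show ?thesis
    unfolding J_def[symmetric]
    by (simp only: sum.distrib two_scale add.assoc)
qed

text \<open>
  Passing between products and brackets costs a factor $1/2$ on each side of the tensor,
  and symmetrizing the sum over $j < k$ another one. On the frame side only the products with
  $a \neq b$ can be turned back, since $e_a$ and $i_a$ do not anticommute; this is why the
  diagonal terms keep their brackets and the coefficient $1/2$.
\<close>

lemma product_contraction_frames:
  assumes x: "orthonormal_basis scaleV g n x" and f: "Vector_Spaces.linear scaleC (*) f"
  shows "(1 / 2) *\<^sub>C (\<Sum>(j, k)\<in>{(j, k). 1 \<le> j \<and> j < k \<and> k \<le> 2 * n}.
      (g (x j) (x j) * g (x k) (x k) * f (\<iota> (x j) * \<iota> (x k))) *\<^sub>C (\<iota> (x j) * \<iota> (x k)))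
    = (\<Sum>a\<in>{1..n}. \<Sum>b\<in>{1..n} - {a}. f (\<iota> (e a) * \<iota> (e b)) *\<^sub>C (\<iota> (i a) * \<iota> (i b)))
      + (\<Sum>a\<in>{1..n}. \<Sum>b\<in>{1..n} - {a}. f (\<iota> (i a) * \<iota> (i b)) *\<^sub>C (\<iota> (e a) * \<iota> (e b)))
      + (\<Sum>a\<in>{1..n}. \<Sum>b\<in>{1..n} - {a}. f (\<iota> (e a) * \<iota> (i b)) *\<^sub>C
            (\<iota> (i a) * \<iota> (e b) - \<iota> (e b) * \<iota> (i a)))
      + (1 / 2) *\<^sub>C (\<Sum>a\<in>{1..n}. f (\<iota> (e a) * \<iota> (i a) - \<iota> (i a) * \<iota> (e a)) *\<^sub>C
            (\<iota> (i a) * \<iota> (e a) - \<iota> (e a) * \<iota> (i a)))"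
proof -
  let ?P = "{(j, k). 1 \<le> j \<and> j < k \<and> k \<le> 2 * n}"
  let ?F = "\<lambda>j k. (g (x j) (x j) * g (x k) (x k) * f (bivector (x j) (x k)))
    *\<^sub>C bivector (x j) (x k)"
  have dyad: "f (\<iota> v * \<iota> w) *\<^sub>C (\<iota> v' * \<iota> w')
      = (1 / 4) *\<^sub>C (f (bivector v w) *\<^sub>C bivector v' w')"
    if "g v w = 0" "g v' w' = 0" for v w v' w'
    using that by (simp add: half_bivector linear_map_scale[OF f])
  have "(\<Sum>(j, k)\<in>?P. (g (x j) (x j) * g (x k) (x k) * f (\<iota> (x j) * \<iota> (x k)))
        *\<^sub>C (\<iota> (x j) * \<iota> (x k)))
    = (\<Sum>(j, k)\<in>?P. (1 / 4) *\<^sub>C ?F j k)"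
  proof (intro sum.cong refl, clarify)
    fix j k :: nat assume "1 \<le> j" "j < k" "k \<le> 2 * n"
    then have "g (x j) (x k) = 0"
      using x by (simp add: orthonormal_basis_def)
    then show "(g (x j) (x j) * g (x k) (x k) * f (\<iota> (x j) * \<iota> (x k)))
        *\<^sub>C (\<iota> (x j) * \<iota> (x k)) = (1 / 4) *\<^sub>C ?F j k"
      by (simp add: half_bivector linear_map_scale[OF f])
  qed
  also have "\<dots> = (1 / 8) *\<^sub>C (2 *\<^sub>C (\<Sum>(j, k)\<in>?P. ?F j k))"
    by (simp only: C.scale_sum_right C.scale_scale case_prod_unfold eighths(1)[symmetric] mult.assoc)
  also have "2 *\<^sub>C (\<Sum>(j, k)\<in>?P. ?F j k) = (\<Sum>j\<in>{1..2*n}. \<Sum>k\<in>{1..2*n}. ?F j k)"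
  proof (subst sum_square_eq_twice_sum_less)
    show "?F j k = ?F k j" for j k
      by (simp add: bivector_swap[of "x k" "x j"] linear_map_neg[OF f] mult_ac)
  qed (simp_all add: two_scale)
  finally have "(1 / 2) *\<^sub>C (\<Sum>(j, k)\<in>?P.
        (g (x j) (x j) * g (x k) (x k) * f (\<iota> (x j) * \<iota> (x k))) *\<^sub>C (\<iota> (x j) * \<iota> (x k)))
    = (1 / 4) *\<^sub>C (\<Sum>a\<in>{1..n}. \<Sum>b\<in>{1..n}.
        f (bivector (e a) (e b)) *\<^sub>C bivector (i a) (i b)
      + f (bivector (i a) (i b)) *\<^sub>C bivector (e a) (e b)
      + 2 *\<^sub>C (f (bivector (e a) (i b)) *\<^sub>C bivector (i a) (e b)))"
    by (simp only: bivector_contraction_frames[OF x f])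
      (simp only: C.scale_scale mult.assoc eighths)
  also have "\<dots> = (\<Sum>a\<in>{1..n}. \<Sum>b\<in>{1..n}.
        (1 / 4) *\<^sub>C (f (bivector (e a) (e b)) *\<^sub>C bivector (i a) (i b))
      + (1 / 4) *\<^sub>C (f (bivector (i a) (i b)) *\<^sub>C bivector (e a) (e b))
      + (1 / 2) *\<^sub>C (f (bivector (e a) (i b)) *\<^sub>C bivector (i a) (e b)))"
    by (simp only: C.scale_sum_right C.scale_right_distrib C.scale_scale mult.assoc[symmetric] eighths)
  also have "\<dots> = (\<Sum>a\<in>{1..n}. (\<Sum>b\<in>{1..n} - {a}.
        f (\<iota> (e a) * \<iota> (e b)) *\<^sub>C (\<iota> (i a) * \<iota> (i b))
      + f (\<iota> (i a) * \<iota> (i b)) *\<^sub>C (\<iota> (e a) * \<iota> (e b))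
      + f (\<iota> (e a) * \<iota> (i b)) *\<^sub>C bivector (i a) (e b))
      + (1 / 2) *\<^sub>C (f (bivector (e a) (i a)) *\<^sub>C bivector (i a) (e a)))"
  proof (intro sum.cong refl)
    fix a assume a: "a \<in> {1..n}"
    have mixed: "f (\<iota> (e a) * \<iota> (i b)) = (1 / 2) * f (bivector (e a) (i b))"
      if "b \<in> {1..n}" "b \<noteq> a" for b
      using that a half_bivector[of "e a" "i b"] by (simp add: e_i_dual linear_map_scale[OF f])
    let ?h = "\<lambda>b. (1 / 4) *\<^sub>C (f (bivector (e a) (e b)) *\<^sub>C bivector (i a) (i b))
      + (1 / 4) *\<^sub>C (f (bivector (i a) (i b)) *\<^sub>C bivector (e a) (e b))
      + (1 / 2) *\<^sub>C (f (bivector (e a) (i b)) *\<^sub>C bivector (i a) (e b))"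
    have "(\<Sum>b\<in>{1..n}. ?h b) = ?h a + (\<Sum>b\<in>{1..n} - {a}. ?h b)"
      by (rule sum.remove) (use a in simp_all)
    also have "?h a = (1 / 2) *\<^sub>C (f (bivector (e a) (i a)) *\<^sub>C bivector (i a) (e a))"
      by simp
    also have "(\<Sum>b\<in>{1..n} - {a}. ?h b) = (\<Sum>b\<in>{1..n} - {a}.
        f (\<iota> (e a) * \<iota> (e b)) *\<^sub>C (\<iota> (i a) * \<iota> (i b))
      + f (\<iota> (i a) * \<iota> (i b)) *\<^sub>C (\<iota> (e a) * \<iota> (e b))
      + f (\<iota> (e a) * \<iota> (i b)) *\<^sub>C bivector (i a) (e b))"
      by (rule sum.cong[OF refl]) (use a in \<open>simp add: dyad e_isotropic i_isotropic mixed\<close>)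
    finally show "(\<Sum>b\<in>{1..n}. ?h b) = (\<Sum>b\<in>{1..n} - {a}.
        f (\<iota> (e a) * \<iota> (e b)) *\<^sub>C (\<iota> (i a) * \<iota> (i b))
      + f (\<iota> (i a) * \<iota> (i b)) *\<^sub>C (\<iota> (e a) * \<iota> (e b))
      + f (\<iota> (e a) * \<iota> (i b)) *\<^sub>C bivector (i a) (e b))
      + (1 / 2) *\<^sub>C (f (bivector (e a) (i a)) *\<^sub>C bivector (i a) (e a))"
      by (simp only: add.commute)
  qed
  finally show ?thesis
    by (simp only: bivector_def sum.distrib C.scale_sum_right add.assoc)
qed

end

section \<open>Clifford algebras and spinors\<close>

lemma two_nonzero_if_CHAR: "CHAR('k::field) \<noteq> 2 \<Longrightarrow> (2::'k) \<noteq> 0"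
proof
  assume ne: "CHAR('k) \<noteq> 2" and "(2::'k) = 0"
  then have "CHAR('k) dvd 2"
    using of_nat_eq_0_iff_char_dvd[where 'a = 'k, of 2] by simp
  moreover have "CHAR('k) \<noteq> 1"
    using of_nat_CHAR[where 'a = 'k] by auto
  moreover have "CHAR('k) \<le> 2"
    using \<open>CHAR('k) dvd 2\<close> by (rule dvd_imp_le) simp
  moreover have "CHAR('k) \<noteq> 0"
    using \<open>CHAR('k) dvd 2\<close> by (metis dvd_0_left_iff zero_neq_numeral)
  ultimately show False
    using ne by linarith
qed

text \<open>
  Each relation holds because the corresponding relator lies in the ideal, hence in the kernel
  of evaluation.
\<close>

lemma clifford_map_if_clifford_algebra:
  assumes char: "(2::'k::field) \<noteq> 0"
    and vs: "vector_space (scaleV :: 'k \<Rightarrow> 'v::ab_group_add \<Rightarrow> 'v)"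
    and g: "bilinear_form scaleV g" "\<And>v w. g v w = g w v"
    and cliff: "clifford_algebra scaleV g scaleC \<iota>"
  shows "clifford_map scaleV scaleC g \<iota>"
proof -
  have alg: "algebra_over scaleC"
    using cliff by (simp add: clifford_algebra_def)
  then have C: "vector_space scaleC"
    by (simp add: algebra_over_def)
  interpret C: vector_space scaleC by (fact C)
  note eval = free_algebra_eval_add[OF C] free_algebra_eval_diff[OF C] free_algebra_eval_single[OF C]
  have relator: "free_algebra_eval scaleC \<iota> r = 0" if "r \<in> clifford_relators scaleV g" for r
    using cliff ideal_generated.generator[OF that] by (auto simp: clifford_algebra_def)
  have "\<iota> (v + w) = \<iota> v + \<iota> w" for v w
  proof -
    have "free_gen (v + w) - free_gen v - free_gen w \<in> clifford_relators scaleV g"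
      unfolding clifford_relators_def by blast
    from relator[OF this] show ?thesis
      by (simp add: eval free_gen_def diff_eq_eq add.commute)
  qed
  moreover have "\<iota> (scaleV a v) = scaleC a (\<iota> v)" for a v
  proof -
    have "free_gen (scaleV a v) - free_const a * free_gen v \<in> clifford_relators scaleV g"
      unfolding clifford_relators_def by blast
    from relator[OF this] show ?thesis
      by (simp add: eval free_gen_def free_const_def mult_single
          plus_free_monoid_def zero_free_monoid_def)
  qed
  moreover have "\<iota> v * \<iota> w + \<iota> w * \<iota> v = scaleC (2 * g v w) 1" for v w
  proof -
    have "free_gen v * free_gen w + free_gen w * free_gen v - free_const (2 * g v w) \<in> clifford_relators scaleV g"
      unfolding clifford_relators_def by blast
    from relator[OF this] show ?thesis
      by (simp add: eval free_gen_def free_const_def mult_single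
          plus_free_monoid_def zero_free_monoid_def)
  qed
  ultimately show ?thesis
    using alg g vs C char
    by (auto simp: clifford_map_def clifford_map_axioms_def algebra_over_def bilinear_form_def
        Vector_Spaces.linear_iff)
qed

text \<open>
  If $1 = 0$ then the identity of the spinor space is the zero map, but its dimension
  $2^n$ is positive even for $n = 0$.
\<close>

lemma spinor_representation_one_nonzero:
  fixes act :: "'c::ring_1 \<Rightarrow> 's::ab_group_add \<Rightarrow> 's"
  assumes "spinor_representation scaleC scaleS n act"
  shows "(1::'c) \<noteq> 0"
proof
  assume one: "(1::'c) = 0"
  interpret S: vector_space scaleS
    using assms by (simp add: spinor_representation_def)
  have "act 0 \<psi> + act 0 \<psi> = act 0 \<psi>" for \<psi>
    using assms unfolding spinor_representation_def by (metis add.right_neutral)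
  then have zero: "\<psi> = 0" for \<psi> :: 's
    using assms one by (simp add: spinor_representation_def)
  obtain X where X: "finite X" "card X = 2 ^ n" "S.independent X"
    using assms by (auto simp: spinor_representation_def has_dimension_def is_basis_of_def)
  then obtain y where "y \<in> X"
    by (metis card.empty equals0I power_not_zero zero_neq_numeral)
  with zero[of y] X(3) show False
    using S.dependent_zero by blast
qed

theorem proposition6p1:
  fixes n :: nat
    and scaleV :: "'k::field \<Rightarrow> 'v::ab_group_add \<Rightarrow> 'v" and g :: "'v \<Rightarrow> 'v \<Rightarrow> 'k"
    and scaleC :: "'k \<Rightarrow> 'c::ring_1 \<Rightarrow> 'c" (infixr \<open>*\<^sub>C\<close> 75) and \<iota> :: "'v \<Rightarrow> 'c"
    and scaleS :: "'k \<Rightarrow> 's::ab_group_add \<Rightarrow> 's"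
    and act :: "'c \<Rightarrow> 's \<Rightarrow> 's" (infixr \<open>\<bullet>\<close> 75)
    and B :: "'s \<Rightarrow> 's \<Rightarrow> 'k"
    and I E :: "'v set" and i e x :: "nat \<Rightarrow> 'v"
  assumes "CHAR('k) \<noteq> 2" and "CHAR('k) \<noteq> 3"
    and "hyperbolic_space scaleV g n"
    and "clifford_algebra scaleV g scaleC \<iota>"
    and "spinor_representation scaleC scaleS n act"
    and "spinor_norm scaleS \<iota> act B" and "nondegenerate B"
    and "maximal_isotropic scaleV g n I" and "maximal_isotropic scaleV g n E"
    and "direct_sum_decomposition I E"
    and "is_basis_family scaleV i n I" and "is_basis_family scaleV e n E"
    and "\<forall>a\<in>{1..n}. \<forall>b\<in>{1..n}. g (e a) (i b) = (if a = b then 1 / 2 else 0)"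
    and "orthonormal_basis scaleV g n x"
  shows "is_basis_of scaleC
      ({\<iota> (e a) * \<iota> (e b) | a b. 1 \<le> a \<and> a < b \<and> b \<le> n}
        \<union> {\<iota> (i a) * \<iota> (i b) | a b. 1 \<le> a \<and> a < b \<and> b \<le> n}
        \<union> {\<iota> (e a) * \<iota> (i b) - \<iota> (i b) * \<iota> (e a) | a b. a \<in> {1..n} \<and> b \<in> {1..n}})
      (C2 scaleC \<iota> n x)
    \<and> (\<forall>\<psi>1 \<psi>2. tilde_L2 g scaleC \<iota> act B n x \<psi>1 \<psi>2 =
        (\<Sum>a\<in>{1..n}. \<Sum>b\<in>{1..n} - {a}. B ((\<iota> (e a) * \<iota> (e b)) \<bullet> \<psi>1) \<psi>2 *\<^sub>C (\<iota> (i a) * \<iota> (i b)))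
      + (\<Sum>a\<in>{1..n}. \<Sum>b\<in>{1..n} - {a}. B ((\<iota> (i a) * \<iota> (i b)) \<bullet> \<psi>1) \<psi>2 *\<^sub>C (\<iota> (e a) * \<iota> (e b)))
      + (\<Sum>a\<in>{1..n}. \<Sum>b\<in>{1..n} - {a}. B ((\<iota> (e a) * \<iota> (i b)) \<bullet> \<psi>1) \<psi>2 *\<^sub>C
            (\<iota> (i a) * \<iota> (e b) - \<iota> (e b) * \<iota> (i a)))
      + (1 / 2) *\<^sub>C (\<Sum>a\<in>{1..n}. B ((\<iota> (e a) * \<iota> (i a) - \<iota> (i a) * \<iota> (e a)) \<bullet> \<psi>1) \<psi>2 *\<^sub>C
            (\<iota> (i a) * \<iota> (e a) - \<iota> (e a) * \<iota> (i a))))"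
proof -
  have space: "vector_space scaleV" "bilinear_form scaleV g" "\<And>v w. g v w = g w v"
    using assms(3) by (auto simp: hyperbolic_space_def)
  interpret clifford_map scaleV scaleC g \<iota>
    by (rule clifford_map_if_clifford_algebra[OF two_nonzero_if_CHAR[OF assms(1)] space assms(4)])
  have "V.span (e ` {1..n} \<union> i ` {1..n}) = UNIV"
  proof -
    have "v \<in> V.span (e ` {1..n} \<union> i ` {1..n})" for v
    proof -
      obtain u w where "u \<in> I" "w \<in> E" "v = u + w"
        using assms(10) unfolding direct_sum_decomposition_def by meson
      then show ?thesis
        using assms(11,12) V.span_mono[of "i ` {1..n}" "e ` {1..n} \<union> i ` {1..n}"]
          V.span_mono[of "e ` {1..n}" "e ` {1..n} \<union> i ` {1..n}"]
        by (auto simp: is_basis_family_def is_basis_of_def intro!: V.span_add)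
    qed
    then show ?thesis by blast
  qed
  moreover have "e a \<in> E" "i a \<in> I" if "a \<in> {1..n}" for a
    using assms(11,12) that V.span_base[of "e a" "e ` {1..n}"] V.span_base[of "i a" "i ` {1..n}"]
    by (auto simp: is_basis_family_def is_basis_of_def)
  ultimately interpret clifford_map_isotropic_frames scaleV scaleC g \<iota> n e i
    using assms(8,9,13)
    by unfold_locales (simp_all add: maximal_isotropic_def isotropic_subspace_def)
  have one: "(1::'c) \<noteq> 0"
    by (rule spinor_representation_one_nonzero[OF assms(5)])
  have act_mult: "(c * d) \<bullet> \<psi> = c \<bullet> d \<bullet> \<psi>" and act_add: "(c + d) \<bullet> \<psi> = c \<bullet> \<psi> + d \<bullet> \<psi>"
    and act_scale: "(r *\<^sub>C c) \<bullet> \<psi> = scaleS r (c \<bullet> \<psi>)" for c d r \<psi>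
    using assms(5) by (simp_all add: spinor_representation_def)
  have B: "bilinear_form scaleS B" and adjoint: "B (\<iota> v \<bullet> \<phi>) \<psi> = B \<phi> (\<iota> v \<bullet> \<psi>)" for v \<phi> \<psi>
    using assms(6) by (simp_all add: spinor_norm_def)
  have B_add: "B (\<phi> + \<phi>') \<psi> = B \<phi> \<psi> + B \<phi>' \<psi>" and B_scale: "B (scaleS r \<phi>) \<psi> = r * B \<phi> \<psi>"
    for \<phi> \<phi>' \<psi> r
    using B by (auto simp: bilinear_form_def Vector_Spaces.linear_iff)
  \<comment> \<open>The form being linear supplies that the field is a vector space over itself.\<close>
  have functional: "Vector_Spaces.linear scaleC (*) (\<lambda>c. B (c \<bullet> \<psi>1) \<psi>2)" for \<psi>1 \<psi>2
    using form_linear C.vector_space_axioms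
    by (simp add: Vector_Spaces.linear_iff act_add act_scale B_add B_scale)
  have move: "B \<psi>1 ((\<iota> (x k) * \<iota> (x j)) \<bullet> \<psi>2) = B ((\<iota> (x j) * \<iota> (x k)) \<bullet> \<psi>1) \<psi>2" for j k \<psi>1 \<psi>2
    by (simp add: act_mult adjoint)
  show ?thesis
    unfolding tilde_L2_def move
    using frame_products_basis[OF one assms(14)]
      product_contraction_frames[OF assms(14) functional] by blast
qed

end
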